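(* Let $m,m_{\mathrm{test}},n,d_y$ be positive integers, and let $\Phi\in\mathbb{R}^{m\times n}$ and $\Phi_{\mathrm{test}}\in\mathbb{R}^{m_{\mathrm{test}}\times n}$ be fixed matrices. For $w\in\mathbb{R}^{n\times d_y}$ put $\hat Y(w)=\Phi w\in\mathbb{R}^{m\times d_y}$ and $\hat Y_{\mathrm{test}}(w)=\Phi_{\mathrm{test}}w\in\mathbb{R}^{m_{\mathrm{test}}\times d_y}$. Let $M=[\Phi^\top,\Phi_{\mathrm{test}}^\top]^\top\in\mathbb{R}^{(m+m_{\mathrm{test}})\times n}$. Suppose $n>m$, $\operatorname{rank}(\Phi)=m$ and $\operatorname{rank}(M)<n$. Then: (i) For any $Y\in\mathbb{R}^{m\times d_y}$ there exists a parameter $w'\in\mathbb{R}^{n\times d_y}$ such that $\hat Y(w')=Y$. (ii) Let $Y\in\mathbb{R}^{m\times d_y}$ and $Y_{\mathrm{test}}\in\mathbb{R}^{m_{\mathrm{test}}\times d_y}$. If there exists $w^*\in\mathbb{R}^{n\times d_y}$ satisfying $Y=\Phi w^*$ and $Y_{\mathrm{test}}=\Phi_{\mathrm{test}}w^*$, then for any $\epsilon,\delta\ge 0$ there exists a parameter $w\in\mathbb{R}^{n\times d_y}$ such that (a) $\hat Y(w)=Y+\epsilon A$ for some matrix $A$ with $\|A\|_F\le 1$, and (b) $\hat Y_{\mathrm{test}}(w)=Y_{\mathrm{test}}+\epsilon B$ for some matrix $B$ with $\|B\|_F\le 1$, and (c) $\|w\|_F\ge\delta$ and $\|w-w^*\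|_F\ge\delta$.
   Context: $\|\cdot\|_F$ is the Frobenius norm. $\Phi$ and $\Phi_{\mathrm{test}}$ are the feature matrices of the training and test inputs of a linear model, $Y$ and $Y_{\mathrm{test}}$ the training and test targets, and $w^*$ is a ground-truth parameter. *)

theory Defs
  imports "HOL-Analysis.Analysis"
begin

definition vstack :: "'a^'n^'m \<Rightarrow> 'a^'n^'k \<Rightarrow> 'a^'n^('m + 'k)" where
  "vstack A B = (\<chi> i. case i of Inl r \<Rightarrow> A $ r | Inr s \<Rightarrow> B $ s)"

definition frobenius_norm :: "real^'n^'m \<Rightarrow> real" where
  "frobenius_norm A = sqrt (\<Sum>i\<in>UNIV. \<Sum>j\<in>UNIV. (A $ i $ j)\<^sup>2)"

lemma frobenius_norm_eq_norm: "frobenius_norm A = norm A"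
  by (simp add: frobenius_norm_def norm_vec_def L2_set_def sum_nonneg)

end

theory Submission
  imports Defs
begin

text \<open>Full row rank makes \<Phi> surjective, so it has a right inverse \<open>R\<close>, and
  \<open>R ** Y\<close> fits any targets \<open>Y\<close>. For the second part, the stacked matrix
  has rank below its number of columns, so some nonzero \<open>x\<close> is killed by both feature
  matrices (\<open>vstack_mult_vec_eq_0_iff\<close>). Repeating \<open>x\<close> as every column
  gives a nonzero matrix \<open>N\<close> that both annihilate
  (\<open>matrix_mult_repeated_column\<close>). Moving from \<open>wstar\<close> along
  \<open>N\<close> changes neither training nor test predictions, while the parameter and its
  distance to \<open>wstar\<close> grow without bound
  (\<open>exists_large_perturbation_along_ray\<close>).\<close>

lemma vstack_mult_vec_eq_0_iff:
  fixes A :: "'a::semiring_1^'n^'m" and B :: "'a^'n^'k"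
  shows "vstack A B *v x = 0 \<longleftrightarrow> A *v x = 0 \<and> B *v x = 0"
  by (auto simp: vec_eq_iff matrix_vector_mult_def vstack_def split: sum.splits)

lemma matrix_mult_repeated_column:
  fixes A :: "'a::semiring_1^'n^'m"
  shows "A ** (\<chi> i j. x $ i) = (\<chi> i j. (A *v x) $ i)"
  by (simp add: matrix_matrix_mult_def matrix_vector_mult_def)

text \<open>By the reverse triangle inequality, a step of length at least \<open>d + norm v\<close>
  leaves length at least \<open>d\<close> even if it points against \<open>v\<close>. One
  \<open>c\<close> thus serves both bounds.\<close>

lemma exists_large_perturbation_along_ray:
  fixes v N :: "'a::real_normed_vector"
  assumes "N \<noteq> 0" and "d \<ge> 0"
  obtains c :: real where "norm (v + c *\<^sub>R N) \<ge> d" and "norm (c *\<^sub>R N) \<ge> d"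
proof
  define c where "c = (d + norm v) / norm N"
  have c: "norm (c *\<^sub>R N) = d + norm v"
    using assms by (simp add: c_def)
  then show "norm (c *\<^sub>R N) \<ge> d"
    by simp
  show "norm (v + c *\<^sub>R N) \<ge> d"
    using c norm_diff_ineq[of "c *\<^sub>R N" v] by (simp add: add.commute)
qed

theorem theorem1:
  fixes \<Phi> :: "real^'n^'m"
    and \<Phi>\<^sub>t\<^sub>e\<^sub>s\<^sub>t :: "real^'n^'k"
  assumes "CARD('n) > CARD('m)"
    and "rank \<Phi> = CARD('m)"
    and "rank (vstack \<Phi> \<Phi>\<^sub>t\<^sub>e\<^sub>s\<^sub>t) < CARD('n)"
  shows "(\<forall>Y :: real^'d^'m. \<exists>w' :: real^'d^'n. \<Phi> ** w' = Y) \<and>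
    (\<forall>(Y :: real^'d^'m) (Y\<^sub>t\<^sub>e\<^sub>s\<^sub>t :: real^'d^'k) (wstar :: real^'d^'n).
      Y = \<Phi> ** wstar \<and> Y\<^sub>t\<^sub>e\<^sub>s\<^sub>t = \<Phi>\<^sub>t\<^sub>e\<^sub>s\<^sub>t ** wstar \<longrightarrow>
      (\<forall>(\<epsilon>::real) \<delta>::real. \<epsilon> \<ge> 0 \<and> \<delta> \<ge> 0 \<longrightarrow>
        (\<exists>w :: real^'d^'n.
          (\<exists>A :: real^'d^'m. frobenius_norm A \<le> 1 \<and> \<Phi> ** w = Y + \<epsilon> *\<^sub>R A) \<and>
          (\<exists>B :: real^'d^'k. frobenius_norm B \<le> 1 \<and> \<Phi>\<^sub>t\<^sub>e\<^sub>s\<^sub>t ** w = Y\<^sub>t\<^sub>e\<^sub>s\<^sub>t + \<epsilon> *\<^sub>R B) \<and>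
          frobenius_norm w \<ge> \<delta> \<and> frobenius_norm (w - wstar) \<ge> \<delta>)))"
proof (intro conjI allI impI)
  fix Y :: "real^'d^'m"
  have "surj ((*v) \<Phi>)"
    using assms(2) by (simp add: full_rank_surjective)
  then obtain R :: "real^'m^'n" where "\<Phi> ** R = mat 1"
    using matrix_right_invertible_surjective by blast
  then have "\<Phi> ** (R ** Y) = Y"
    by (simp add: matrix_mul_assoc)
  then show "\<exists>w' :: real^'d^'n. \<Phi> ** w' = Y" ..
next
  fix Y :: "real^'d^'m" and Yt :: "real^'d^'k" and wstar :: "real^'d^'n" and \<epsilon> \<delta> :: real
  assume Y: "Y = \<Phi> ** wstar \<and> Yt = \<Phi>\<^sub>t\<^sub>e\<^sub>s\<^sub>t ** wstar" and "\<epsilon> \<ge> 0 \<and> \<delta> \<ge> 0"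
  obtain x where "x \<noteq> 0" and "vstack \<Phi> \<Phi>\<^sub>t\<^sub>e\<^sub>s\<^sub>t *v x = 0"
    using assms(3) matrix_nonfull_linear_equations_eq[of "vstack \<Phi> \<Phi>\<^sub>t\<^sub>e\<^sub>s\<^sub>t"] by auto
  then have x: "\<Phi> *v x = 0" "\<Phi>\<^sub>t\<^sub>e\<^sub>s\<^sub>t *v x = 0"
    by (simp_all add: vstack_mult_vec_eq_0_iff)
  \<comment> \<open>The parameter has a column for each output coordinate; using \<open>x\<close> in
    all of them avoids singling out an index of \<open>'d\<close>. Since \<open>'d\<close> is
    nonempty, \<open>N\<close> inherits nonzeroness from \<open>x\<close>.\<close>
  define N :: "real^'d^'n" where "N = (\<chi> i j. x $ i)"
  have "N \<noteq> 0"
    using \<open>x \<noteq> 0\<close> by (simp add: N_def vec_eq_iff)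
  have N: "\<Phi> ** N = 0" "\<Phi>\<^sub>t\<^sub>e\<^sub>s\<^sub>t ** N = 0"
    by (simp_all add: N_def matrix_mult_repeated_column x vec_eq_iff)
  obtain c where c: "norm (wstar + c *\<^sub>R N) \<ge> \<delta>" "norm (c *\<^sub>R N) \<ge> \<delta>"
    using exists_large_perturbation_along_ray[OF \<open>N \<noteq> 0\<close>] \<open>\<epsilon> \<ge> 0 \<and> \<delta> \<ge> 0\<close> by blast
  \<comment> \<open>The predictions are matched exactly, so the error matrices \<open>A\<close> and
    \<open>B\<close> are both 0, whatever the value of \<epsilon>. The term
    \<open>\<epsilon> *\<^sub>R 0\<close> is kept only to match the shape of the goal.\<close>
  have "\<Phi> ** (wstar + c *\<^sub>R N) = Y + \<epsilon> *\<^sub>R 0" "\<Phi>\<^sub>t\<^sub>e\<^sub>s\<^sub>t ** (wstar + c *\<^sub>R N) = Yt + \<epsilon> *\<^sub>R 0"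
    using Y N by (simp_all add: matrix_add_ldistrib matrix_scalar_ac flip: scalar_matrix_assoc)
  then show "\<exists>w :: real^'d^'n.
      (\<exists>A :: real^'d^'m. frobenius_norm A \<le> 1 \<and> \<Phi> ** w = Y + \<epsilon> *\<^sub>R A) \<and>
      (\<exists>B :: real^'d^'k. frobenius_norm B \<le> 1 \<and> \<Phi>\<^sub>t\<^sub>e\<^sub>s\<^sub>t ** w = Yt + \<epsilon> *\<^sub>R B) \<and>
      frobenius_norm w \<ge> \<delta> \<and> frobenius_norm (w - wstar) \<ge> \<delta>"
    using c by (intro exI[of _ "wstar + c *\<^sub>R N"] conjI exI[of _ 0])
      (simp_all add: frobenius_norm_eq_norm)
qed

end
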